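(* Let $a,b,c,d$ be positive integers such that $b<a$, $d<c$, and $\gcd(a,c)$ does not divide $d-b$. Define $\phi:\mathbb{N}\to\mathbb{N}$ (where $\mathbb{N}=\{1,2,3,\dots\}$) by \[ \phi(n)=\begin{cases} c\,\frac{n-b}{a}+d & \text{if } n\equiv b \pmod a,\\ a\,\frac{n-d}{c}+b & \text{if } n\equiv d \pmod c,\\ n & \text{otherwise.}\end{cases}\] Then $\phi$ is a permutation (bijection) of the positive integers, and the series $\sum_{n=1}^\infty \frac{(-1)^{\phi(n)+1}}{\phi(n)}$ converges, with \[\sum_{n=1}^\infty\frac{(-1)^{\phi(n)+1}}{\phi(n)}=\log(2)+\log\Big(\frac{c}{a}\Big)\frac{(-1)^b+(-1)^{a+b}}{2a}+\log\Big(\frac{a}{c}\Big)\frac{(-1)^{d}+(-1)^{c+d}}{2c}.\]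
   Context: The series $\sum_{n=1}^\infty (-1)^{n+1}/n$ is the alternating harmonic series (with sum $\log 2$); the series in the claim is its rearrangement induced by $\phi$, and its sum means the limit of its partial sums $\sum_{n=1}^N (-1)^{\phi(n)+1}/\phi(n)$ as $N\to\infty$. *)

theory Defs
  imports Complex_Main "HOL-Number_Theory.Cong"
begin

text \<open>
  Positive integers are represented as \<^typ>\<open>nat\<close>, and only arguments \<open>n \<ge> 1\<close> are of interest.
  For \<open>n \<ge> 1\<close> and \<open>0 < b < a\<close>, the congruence \<open>n \<equiv> b (mod a)\<close> forces \<open>n \<ge> b\<close>, so the natural
  subtraction and the division by \<open>a\<close> are exact; likewise for \<open>c\<close> and \<open>d\<close>. The first two cases
  are mutually exclusive when \<open>gcd a c\<close> does not divide \<open>d - b\<close>, so their order is immaterial.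
\<close>

definition phi :: "nat \<Rightarrow> nat \<Rightarrow> nat \<Rightarrow> nat \<Rightarrow> nat \<Rightarrow> nat" where
  "phi a b c d n =
     (if [n = b] (mod a) then c * ((n - b) div a) + d
      else if [n = d] (mod c) then a * ((n - d) div c) + b
      else n)"

end

theory Submission
  imports "HOL-Analysis.Gamma_Function" Defs
begin

text \<open>
  The map \<open>\<phi>\<close> is an involution swapping \<open>a k + b\<close> with \<open>c k + d\<close>. Write \<open>F(K)\<close> and \<open>G(K)\<close> for the
  sums of the first \<open>K\<close> terms of the alternating harmonic series whose indices are \<open>a k + b\<close> and
  \<open>c k + d\<close>, respectively, and let \<open>p\<close> and \<open>q\<close> be the numbers of such indices up to \<open>N\<close>. The \<open>N\<close>-th
  partial sums of the rearranged and the original series differ by \<open>F(q) - F(p) + G(p) - G(q)\<close>.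
  Now \<open>F(K) - L log K\<close> converges, where \<open>L\<close> vanishes for odd \<open>a\<close> (Leibniz) and is \<open>\<plusminus>1/a\<close> for even \<open>a\<close>
  (digamma asymptotics), and \<open>q/p\<close> tends to \<open>a/c\<close>, so \<open>F(q) - F(p)\<close> tends to \<open>L log (a/c)\<close>; likewise
  for \<open>G\<close>.
\<close>

definition progression_sum :: "(nat \<Rightarrow> 'a::comm_monoid_add) \<Rightarrow> nat \<Rightarrow> nat \<Rightarrow> nat \<Rightarrow> 'a" where
  "progression_sum f a b K = (\<Sum>k<K. f (a * k + b))"

definition progression_count :: "nat \<Rightarrow> nat \<Rightarrow> nat \<Rightarrow> nat" where
  "progression_count a b N = (N + a - b) div a"

lemma cong_less_modulus_iff:
  fixes a b n :: nat
  assumes "b < a"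
  shows "[n = b] (mod a) \<longleftrightarrow> (\<exists>k. n = a * k + b)"
proof
  assume "[n = b] (mod a)"
  then have "n mod a = b"
    using assms by (simp add: cong_def)
  then have "n = a * (n div a) + b"
    using mult_div_mod_eq[of a n] by simp
  then show "\<exists>k. n = a * k + b" ..
qed (auto simp: cong_def)

lemma residue_classes_disjoint:
  fixes a b c d n :: nat
  assumes "\<not> [b = d] (mod gcd a c)" "[n = b] (mod a)"
  shows "\<not> [n = d] (mod c)"
  using assms by (meson cong_dvd_modulus_nat cong_sym cong_trans gcd_dvd1 gcd_dvd2)

lemma less_progression_count_iff:
  assumes "b < a"
  shows "k < progression_count a b N \<longleftrightarrow> a * k + b \<le> N"
proof -
  have "k < progression_count a b N \<longleftrightarrow> Suc k * a \<le> N + a - b"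
    using assms by (simp add: progression_count_def less_eq_div_iff_mult_less_eq flip: Suc_le_eq)
  also have "\<dots> \<longleftrightarrow> a * k + b \<le> N"
    using assms by (auto simp: algebra_simps)
  finally show ?thesis .
qed

lemma residue_class_upto_eq_image:
  assumes "0 < b" "b < a"
  shows "{n \<in> {1..N}. [n = b] (mod a)} = (\<lambda>k. a * k + b) ` {..<progression_count a b N}"
  using assms by (auto simp: cong_less_modulus_iff less_progression_count_iff)

lemma sum_residue_class_upto:
  assumes "0 < b" "b < a"
  shows "sum f {n \<in> {1..N}. [n = b] (mod a)} =
    progression_sum f a b (progression_count a b N)"
proof -
  have "inj_on (\<lambda>k. a * k + b) {..<progression_count a b N}"
    using assms by (auto intro: inj_onI)
  then show ?thesis
    by (simp only: residue_class_upto_eq_image[OF assms] sum.reindex progression_sum_def o_def)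
qed

lemma progression_count_bounds:
  assumes "b < a"
  shows "\<bar>real a * real (progression_count a b N) - real N\<bar> \<le> real a"
proof -
  let ?p = "progression_count a b N"
  have "N < a * ?p + b"
    using less_progression_count_iff[OF assms, of ?p N] by simp
  moreover have "a * ?p \<le> N + a"
    using less_progression_count_iff[OF assms, of "?p - 1" N] by (cases ?p) auto
  ultimately have "real N \<le> real (a * ?p + a)" "real (a * ?p) \<le> real (N + a)"
    using assms by (simp_all only: of_nat_le_iff)
  then show ?thesis
    by simp
qed

lemma progression_count_density:
  assumes "b < a"
  shows "(\<lambda>N. real (progression_count a b N) / real N) \<longlonglongrightarrow> 1 / real a"
proof (rule LIM_zero_cancel, rule Lim_null_comparison)
  show "\<forall>\<^sub>F N in sequentially.
    norm (real (progression_count a b N) / real N - 1 / real a) \<le> 1 / real N"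
    using eventually_gt_at_top[of 0]
  proof eventually_elim
    case (elim N)
    have "real (progression_count a b N) / real N - 1 / real a =
        (real a * real (progression_count a b N) - real N) / (real a * real N)"
      using elim assms by (simp add: field_simps)
    also have "norm \<dots> =
        \<bar>real a * real (progression_count a b N) - real N\<bar> / (real a * real N)"
      by (simp add: abs_mult)
    also have "\<dots> \<le> real a / (real a * real N)"
      using progression_count_bounds[OF assms] by (intro divide_right_mono) auto
    finally show ?case
      using assms by simp
  qed
qed (rule lim_1_over_n)

lemma filterlim_progression_count:
  assumes "b < a"
  shows "filterlim (progression_count a b) at_top at_top"
proof (rule filterlim_at_top_mono[OF filterlim_at_top_div_const_nat])
  show "\<forall>\<^sub>F N in at_top. N div a \<le> progression_count a b N"
    using assms by (intro always_eventually allI) (simp add: progression_count_def div_le_mono)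
qed (use assms in simp)

lemma progression_count_ratio_tendsto:
  assumes "b < a" "d < c"
  shows "(\<lambda>N. real (progression_count c d N) / real (progression_count a b N))
    \<longlonglongrightarrow> real a / real c"
proof -
  have "(\<lambda>N. (real (progression_count c d N) / real N) / (real (progression_count a b N) / real N))
      \<longlonglongrightarrow> (1 / real c) / (1 / real a)"
    using assms by (intro tendsto_divide progression_count_density) auto
  moreover have "\<forall>\<^sub>F N in sequentially.
      (real (progression_count c d N) / real N) / (real (progression_count a b N) / real N) =
      real (progression_count c d N) / real (progression_count a b N)"
    using eventually_gt_at_top[of 0] by eventually_elim simp
  ultimately have "(\<lambda>N. real (progression_count c d N) / real (progression_count a b N))
      \<longlonglongrightarrow> (1 / real c) / (1 / real a)"
    by (rule Lim_transform_eventually)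
  then show ?thesis
    by simp
qed

lemma phi_first_progression:
  assumes "0 < a"
  shows "phi a b c d (a * k + b) = c * k + d"
  using assms by (simp add: phi_def cong_def)

lemma phi_commute:
  assumes "\<not> [b = d] (mod gcd a c)"
  shows "phi a b c d = phi c d a b"
  using residue_classes_disjoint[OF assms] by (auto simp: phi_def fun_eq_iff)

lemma phi_second_progression:
  assumes "0 < c" "\<not> [b = d] (mod gcd a c)"
  shows "phi a b c d (c * k + d) = a * k + b"
  using phi_first_progression[OF assms(1)] by (simp only: phi_commute[OF assms(2)])

lemma phi_involution:
  assumes "b < a" "d < c" "\<not> [b = d] (mod gcd a c)"
  shows "phi a b c d (phi a b c d n) = n"
proof -
  consider (first) k where "n = a * k + b" | (second) k where "n = c * k + d"
    | (neither) "\<not> [n = b] (mod a)" "\<not> [n = d] (mod c)"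
    using assms by (auto simp: cong_less_modulus_iff)
  then show ?thesis
  proof cases
    case neither
    then show ?thesis by (simp add: phi_def)
  qed (use assms in \<open>simp_all add: phi_first_progression phi_second_progression\<close>)
qed

lemma bij_betw_phi:
  assumes "0 < b" "0 < d" "b < a" "d < c" "\<not> [b = d] (mod gcd a c)"
  shows "bij_betw (phi a b c d) {1..} {1..}"
proof (rule bij_betw_byWitness)
  show "phi a b c d ` {1..} \<subseteq> {1..}"
    using assms by (auto simp: phi_def)
  then show "phi a b c d ` {1..} \<subseteq> {1..}" .
qed (use assms in \<open>simp_all add: phi_involution\<close>)

lemma sum_phi:
  fixes f :: "nat \<Rightarrow> 'a::ab_group_add"
  assumes "0 < b" "b < a" "0 < d" "d < c" "\<not> [b = d] (mod gcd a c)"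
  defines "p \<equiv> progression_count a b" and "q \<equiv> progression_count c d"
  shows "(\<Sum>n = 1..N. f (phi a b c d n)) = (\<Sum>n = 1..N. f n)
    + (progression_sum f a b (q N) - progression_sum f a b (p N))
    + (progression_sum f c d (p N) - progression_sum f c d (q N))"
proof -
  define change where "change n = f (phi a b c d n) - f n" for n
  let ?A = "{n \<in> {1..N}. [n = b] (mod a)}" and ?C = "{n \<in> {1..N}. [n = d] (mod c)}"
  have "sum change {1..N} = sum change (?A \<union> ?C)"
    by (rule sum.mono_neutral_right) (auto simp: change_def phi_def)
  also have "\<dots> = sum change ?A + sum change ?C"
    using residue_classes_disjoint[OF assms(5)] by (intro sum.union_disjoint) auto
  also have "sum change ?A = progression_sum f c d (p N) - progression_sum f a b (p N)"
    unfolding p_def sum_residue_class_upto[OF assms(1,2)] using assms(1-5)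
    by (simp add: progression_sum_def change_def phi_first_progression sum_subtractf)
  also have "sum change ?C = progression_sum f a b (q N) - progression_sum f c d (q N)"
    unfolding q_def sum_residue_class_upto[OF assms(3,4)] using assms(1-5)
    by (simp add: progression_sum_def change_def phi_second_progression sum_subtractf)
  finally show ?thesis
    by (simp add: change_def sum_subtractf algebra_simps)
qed

definition alt_harmonic_term :: "nat \<Rightarrow> real" where
  "alt_harmonic_term n = (-1) ^ (n + 1) / real n"

text \<open>
  The signs at \<open>a k + b\<close> repeat after two steps of \<open>k\<close>; their mean over such a period is divided
  by the step \<open>a\<close>.
\<close>
definition log_growth_coeff :: "nat \<Rightarrow> nat \<Rightarrow> real" where
  "log_growth_coeff a b = ((-1) ^ (b + 1) + (-1) ^ (a + b + 1)) / (2 * real a)"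

lemma sum_inverse_progression_LIMSEQ:
  fixes a b :: real
  assumes "a \<noteq> 0" "b \<noteq> 0"
  shows "(\<lambda>K. (\<Sum>k<K. 1 / (a * real k + b)) - ln (real K) / a) \<longlonglongrightarrow> - Digamma (b / a) / a"
proof -
  have "1 / (a * real k + b) = inverse (b / a + real k) / a" for k
  proof -
    have "a * real k + b = a * (b / a + real k)"
      using assms by (simp add: field_simps)
    then show ?thesis
      by (simp only: divide_inverse inverse_mult_distrib mult_1 mult.commute)
  qed
  then have "(\<Sum>k<K. 1 / (a * real k + b)) - ln (real K) / a =
      - (ln (real K) - (\<Sum>k<K. inverse (b / a + real k))) / a" for K
    by (simp add: sum_divide_distrib diff_divide_distrib)
  moreover have "(\<lambda>K. - (ln (real K) - (\<Sum>k<K. inverse (b / a + real k))) / a)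
      \<longlonglongrightarrow> - Digamma (b / a) / a"
    using Digamma_LIMSEQ[of "b / a"] assms by (intro tendsto_intros) auto
  ultimately show ?thesis
    by simp
qed

lemma summable_alternating_progression:
  fixes a b :: real
  assumes "0 < a" "0 < b"
  shows "summable (\<lambda>k. (-1) ^ k / (a * real k + b))"
proof -
  have denominator_at_top: "filterlim (\<lambda>k. b + a * real k) at_top sequentially"
    using assms(1) by (intro filterlim_tendsto_add_at_top[OF tendsto_const]
        filterlim_tendsto_pos_mult_at_top[OF tendsto_const] filterlim_real_sequentially)
  have "summable (\<lambda>k. (-1) ^ k * (1 / (a * real k + b)))"
  proof (rule summable_Leibniz')
    show "(\<lambda>k. 1 / (a * real k + b)) \<longlonglongrightarrow> 0"
      using denominator_at_top
      by (intro tendsto_divide_0[OF tendsto_const] filterlim_at_top_imp_at_infinity)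
        (simp add: add.commute)
    show "1 / (a * real (Suc k) + b) \<le> 1 / (a * real k + b)" for k
      using assms by (intro frac_le add_nonneg_pos add_mono mult_left_mono) auto
  qed (use assms in auto)
  then show ?thesis by simp
qed

lemma alt_harmonic_progression_sum_convergent:
  assumes "0 < a" "0 < b"
  shows "convergent (\<lambda>K. progression_sum alt_harmonic_term a b K
    - log_growth_coeff a b * ln (real K))"
proof (cases "even a")
  case True
  have "progression_sum alt_harmonic_term a b K - log_growth_coeff a b * ln (real K) =
      (-1) ^ (b + 1) * ((\<Sum>k<K. 1 / (real a * real k + real b)) - ln (real K) / real a)" for K
    using True by (simp add: progression_sum_def alt_harmonic_term_def log_growth_coeff_def
        power_add power_mult sum_distrib_left right_diff_distrib sum_negf)
  moreover have "convergent (\<lambda>K. (\<Sum>k<K. 1 / (real a * real k + real b)) - ln (real K) / real a)"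
    using sum_inverse_progression_LIMSEQ[of "real a" "real b"] assms by (auto intro: convergentI)
  ultimately show ?thesis
    by (simp only: convergent_mult[OF convergent_const])
next
  case False
  then have "(-1) ^ (a * k) = ((-1) ^ k :: real)" for k
    by (simp add: power_mult)
  then have "progression_sum alt_harmonic_term a b K - log_growth_coeff a b * ln (real K) =
      (-1) ^ (b + 1) * (\<Sum>k<K. (-1) ^ k / (real a * real k + real b))" for K
    using False by (simp add: progression_sum_def alt_harmonic_term_def log_growth_coeff_def
        power_add sum_distrib_left mult_ac)
  moreover have "convergent (\<lambda>K. \<Sum>k<K. (-1) ^ k / (real a * real k + real b))"
    using assms summable_alternating_progression by (simp flip: summable_iff_convergent)
  ultimately show ?thesis
    by (simp only: convergent_mult[OF convergent_const])
qed

lemma log_growth_diff_tendsto: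
  fixes S :: "nat \<Rightarrow> real" and p q :: "'a \<Rightarrow> nat"
  assumes "convergent (\<lambda>K. S K - L * ln (real K))"
    and "filterlim p at_top F" "filterlim q at_top F"
    and "((\<lambda>x. real (q x) / real (p x)) \<longlongrightarrow> r) F" "r \<noteq> 0"
  shows "((\<lambda>x. S (q x) - S (p x)) \<longlongrightarrow> L * ln r) F"
proof -
  define h where "h K = S K - L * ln (real K)" for K
  obtain l where "h \<longlonglongrightarrow> l"
    using assms(1) unfolding h_def convergent_def by blast
  then have "((\<lambda>x. h (p x)) \<longlongrightarrow> l) F" "((\<lambda>x. h (q x)) \<longlongrightarrow> l) F"
    using assms(2,3) by (auto intro: filterlim_compose)
  then have "((\<lambda>x. (h (q x) - h (p x)) + L * ln (real (q x) / real (p x)))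
      \<longlongrightarrow> (l - l) + L * ln r) F"
    using assms(4,5) by (intro tendsto_intros)
  moreover have "\<forall>\<^sub>F x in F. (h (q x) - h (p x)) + L * ln (real (q x) / real (p x)) =
      S (q x) - S (p x)"
  proof -
    have "\<forall>\<^sub>F x in F. 0 < p x" "\<forall>\<^sub>F x in F. 0 < q x"
      using assms(2,3) by (auto intro: eventually_compose_filterlim[OF eventually_gt_at_top])
    then show ?thesis
      by eventually_elim (simp add: h_def ln_div algebra_simps)
  qed
  ultimately show ?thesis
    by (simp add: tendsto_cong)
qed

lemma alt_harmonic_progression_sum_diff_tendsto:
  assumes "0 < b" "b < a" "d < c"
  shows "(\<lambda>N. progression_sum alt_harmonic_term a b (progression_count c d N)
      - progression_sum alt_harmonic_term a b (progression_count a b N))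
    \<longlonglongrightarrow> log_growth_coeff a b * ln (real a / real c)"
  using assms
  by (intro log_growth_diff_tendsto alt_harmonic_progression_sum_convergent
      filterlim_progression_count progression_count_ratio_tendsto) auto

theorem theorem1:
  fixes a b c d :: nat
  assumes "a > 0" and "b > 0" and "c > 0" and "d > 0"
    and "b < a" and "d < c"
    and "\<not> int (gcd a c) dvd (int d - int b)"
  shows "bij_betw (phi a b c d) {1..} {1..} \<and>
    (\<lambda>n. (-1) ^ (phi a b c d (Suc n) + 1) / real (phi a b c d (Suc n))) sums
      (ln 2
        + ln (real c / real a) * (((-1) ^ b + (-1) ^ (a + b)) / (2 * real a))
        + ln (real a / real c) * (((-1) ^ d + (-1) ^ (c + d)) / (2 * real c)))"
proof
  have incongruent: "\<not> [b = d] (mod gcd a c)"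
    using assms(7) by (metis cong_iff_dvd_diff cong_int_iff cong_sym)
  then show "bij_betw (phi a b c d) {1..} {1..}"
    using assms by (intro bij_betw_phi)
  have "(\<lambda>N. \<Sum>n = 1..N. alt_harmonic_term n) \<longlonglongrightarrow> ln 2"
    using alternating_harmonic_series_sums
    by (simp add: sums_def alt_harmonic_term_def sum.atLeast1_atMost_eq)
  then have "(\<lambda>N. \<Sum>n = 1..N. alt_harmonic_term (phi a b c d n)) \<longlonglongrightarrow>
      ln 2 + log_growth_coeff a b * ln (real a / real c) + log_growth_coeff c d * ln (real c / real a)"
    unfolding sum_phi[OF assms(2,5,4,6) incongruent]
    using assms by (intro tendsto_add alt_harmonic_progression_sum_diff_tendsto)
  also have "ln 2 + log_growth_coeff a b * ln (real a / real c)
        + log_growth_coeff c d * ln (real c / real a) =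
      ln 2 + ln (real c / real a) * (((-1) ^ b + (-1) ^ (a + b)) / (2 * real a))
        + ln (real a / real c) * (((-1) ^ d + (-1) ^ (c + d)) / (2 * real c))"
    using assms by (simp add: log_growth_coeff_def ln_div field_simps)
  finally show "(\<lambda>n. (-1) ^ (phi a b c d (Suc n) + 1) / real (phi a b c d (Suc n))) sums \<dots>"
    by (simp add: sums_def alt_harmonic_term_def sum.atLeast1_atMost_eq)
qed

end
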